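(* Let $p(z)$ be a complex polynomial of degree $n$ that has $m$ zeros on the unit circle $\mathbb{S}$, counted with multiplicity, and such that $p(1)\neq 0$. Then the transformed polynomial $q_\mu(z)$ has exactly $m$ zeros on $\mathbb{R}$, counted with multiplicity. Similarly, if $p(z)$ is a complex polynomial of degree $n$ that has $m$ zeros on $\mathbb{R}$, counted with multiplicity, and such that $p(-i)\neq 0$, then the transformed polynomial $q_\omega(z)$ has exactly $m$ zeros on $\mathbb{S}$, counted with multiplicity.
   Context: $\mathbb{S}=\{z\in\mathbb{C}:|z|=1\}$. The Cayley transformations are $\mu(z)=\frac{z-i}{z+i}$ and $\omega(z)=-i\,\frac{z+1}{z-1}$. For a complex polynomial $p(z)=\sum_{k=0}^n p_k z^k$ of degree $n$ (so $p_n\ne 0$), the transformed polynomials are $q_\mu(z)=(z+i)^n p(\mu(z))=\sum_{k=0}^n p_k (z-i)^k(z+i)^{n-k}$ and $q_\omega(z)=\left(\tfrac{i}{2}\right)^n (z-1)^n p(\omega(z))=\left(\tfrac{i}{2}\right)^n\sum_{k=0}^n p_k(-i)^k(z+1)^k(z-1)^{n-k}$. *)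

theory Defs
  imports "HOL-Analysis.Analysis" "HOL-Computational_Algebra.Computational_Algebra"
begin

text \<open>As total functions, these take the junk value 0 at their poles \<open>-\<i>\<close> and \<open>1\<close>.\<close>

definition cayley_mu :: "complex \<Rightarrow> complex" where
  "cayley_mu z = (z - \<i>) / (z + \<i>)"

definition cayley_omega :: "complex \<Rightarrow> complex" where
  "cayley_omega z = - \<i> * ((z + 1) / (z - 1))"

text \<open>
  The transformed polynomials, for use with \<open>n = degree p\<close>. They are defined by the expanded sums,
  as elements of \<^typ>\<open>complex poly\<close>, so that they have zeros and multiplicities at the poles of
  the Cayley maps too. Lemmas \<open>poly_q_mu\<close> and \<open>poly_q_omega\<close> below give the closed forms.
\<close>

definition q_mu :: "nat \<Rightarrow> complex poly \<Rightarrow> complex poly" where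
  "q_mu n p = (\<Sum>k\<le>n. smult (coeff p k) ([:- \<i>, 1:] ^ k * [:\<i>, 1:] ^ (n - k)))"

definition q_omega :: "nat \<Rightarrow> complex poly \<Rightarrow> complex poly" where
  "q_omega n p = smult ((\<i> / 2) ^ n)
     (\<Sum>k\<le>n. smult (coeff p k * (- \<i>) ^ k) ([:1, 1:] ^ k * [:- 1, 1:] ^ (n - k)))"

text \<open>
  The zero polynomial has to be excluded explicitly: its \<^const>\<open>proots\<close> is the empty multiset
  by convention.
\<close>

definition has_zeros_on :: "complex poly \<Rightarrow> complex set \<Rightarrow> nat \<Rightarrow> bool" where
  "has_zeros_on p A m \<longleftrightarrow> p \<noteq> 0 \<and> size {# z \<in># proots p. z \<in> A #} = m"

abbreviation unit_circle :: "complex set" where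
  "unit_circle \<equiv> {z. cmod z = 1}"

lemma has_zeros_on_altdef:
  "has_zeros_on p A m \<longleftrightarrow> p \<noteq> 0 \<and> (\<Sum>z | z \<in> A \<and> poly p z = 0. order z p) = m"
proof (cases "p = 0")
  case False
  then have s: "set_mset (filter_mset (\<lambda>z. z \<in> A) (proots p)) = {z \<in> A. poly p z = 0}"
    by auto
  have "size (filter_mset (\<lambda>z. z \<in> A) (proots p)) = (\<Sum>z | z \<in> A \<and> poly p z = 0. order z p)"
    unfolding size_multiset_overloaded_eq s using False by (intro sum.cong) auto
  then show ?thesis by (simp add: has_zeros_on_def)
qed (simp add: has_zeros_on_def)

lemma homogenize_eq:
  fixes a b w :: complex
  assumes "k \<le> n" "b \<noteq> 0"
  shows "a ^ k * b ^ (n - k) = b ^ n * (a / b) ^ k"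
  using assms by (simp add: power_divide power_diff)

lemma poly_q_mu:
  assumes "z \<noteq> - \<i>"
  shows "poly (q_mu (degree p) p) z = (z + \<i>) ^ degree p * poly p (cayley_mu z)"
proof -
  have nz: "z + \<i> \<noteq> 0"
    using assms by (simp add: add_eq_0_iff2)
  have "poly (q_mu (degree p) p) z =
      (\<Sum>k\<le>degree p. coeff p k * ((z - \<i>) ^ k * (z + \<i>) ^ (degree p - k)))"
    by (simp add: q_mu_def poly_sum algebra_simps)
  also have "\<dots> = (\<Sum>k\<le>degree p. (z + \<i>) ^ degree p * (coeff p k * cayley_mu z ^ k))"
    by (intro sum.cong refl) (simp add: homogenize_eq[OF _ nz] cayley_mu_def)
  finally show ?thesis by (simp add: poly_altdef sum_distrib_left)
qed

lemma poly_q_omega: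
  assumes "z \<noteq> 1"
  shows "poly (q_omega (degree p) p) z =
    (\<i> / 2) ^ degree p * (z - 1) ^ degree p * poly p (cayley_omega z)"
proof -
  have nz: "z - 1 \<noteq> 0"
    using assms by simp
  have "poly (q_omega (degree p) p) z = (\<i> / 2) ^ degree p *
      (\<Sum>k\<le>degree p. coeff p k * (- \<i>) ^ k * ((z + 1) ^ k * (z - 1) ^ (degree p - k)))"
    by (simp add: q_omega_def poly_sum algebra_simps)
  also have "(\<Sum>k\<le>degree p. coeff p k * (- \<i>) ^ k * ((z + 1) ^ k * (z - 1) ^ (degree p - k))) =
      (\<Sum>k\<le>degree p. (z - 1) ^ degree p * (coeff p k * cayley_omega z ^ k))"
  proof (intro sum.cong refl)
    fix k assume "k \<in> {..degree p}"
    then have "(z + 1) ^ k * (z - 1) ^ (degree p - k) = (z - 1) ^ degree p * ((z + 1) / (z - 1)) ^ k"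
      using nz by (intro homogenize_eq) auto
    moreover have "cayley_omega z ^ k = (- \<i>) ^ k * ((z + 1) / (z - 1)) ^ k"
      by (simp only: cayley_omega_def power_mult_distrib)
    ultimately show "coeff p k * (- \<i>) ^ k * ((z + 1) ^ k * (z - 1) ^ (degree p - k)) =
        (z - 1) ^ degree p * (coeff p k * cayley_omega z ^ k)"
      by (simp only: ac_simps)
  qed
  finally show ?thesis by (simp add: poly_altdef sum_distrib_left mult.assoc)
qed

end

theory Submission
  imports Defs
begin

text \<open>
  Both transforms are homogenizations \<open>\<Sum>k\<le>n. p\<^sub>k a\<^sup>k b\<^sup>n\<^sup>-\<^sup>k\<close> with \<open>a\<close>, \<open>b\<close> polynomials of
  degree one. Homogenization is multiplicative, so a factor \<open>z - c\<close> of \<open>p\<close> becomes a factor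
  \<open>a - c b\<close> of the transform. That factor is linear or a nonzero constant, and its zero, if any, is
  the preimage of \<open>c\<close> under the Cayley map, which lies on the target curve iff \<open>c\<close> lies on the
  source curve.
\<close>

definition homogenize :: "'a::comm_ring_1 poly \<Rightarrow> 'a poly \<Rightarrow> nat \<Rightarrow> 'a poly \<Rightarrow> 'a poly" where
  "homogenize a b n p = (\<Sum>k\<le>n. smult (coeff p k) (a ^ k * b ^ (n - k)))"

lemma homogenize_diff:
  "homogenize a b n (p - q) = homogenize a b n p - homogenize a b n q"
  by (simp add: homogenize_def smult_diff_left sum_subtractf)

lemma homogenize_smult: "homogenize a b n (smult c p) = smult c (homogenize a b n p)"
  \<comment> \<open>Multiplying by the constant polynomial \<open>[:c:]\<close> is
    \<open>smult c\<close>, so this instance distributes \<open>smult\<close> over the sum.\<close>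
  by (simp add: homogenize_def sum_distrib_left[of "[:c:]", simplified])

lemma homogenize_pCons_0: "homogenize a b (Suc n) (pCons 0 p) = a * homogenize a b n p"
  by (simp add: homogenize_def sum.atMost_Suc_shift sum_distrib_left mult.assoc
      del: sum.atMost_Suc)

text \<open>The new top coefficient is 0 by the degree bound, and every other term gains one factor
  \<open>b\<close>.\<close>

lemma homogenize_Suc:
  assumes "degree p \<le> n"
  shows "homogenize a b (Suc n) p = b * homogenize a b n p"
  using assms
  by (auto simp: homogenize_def coeff_eq_0 sum_distrib_left Suc_diff_le mult_ac intro!: sum.cong)

text \<open>Split the product into a shift of \<open>p\<close>, which contributes \<open>a\<close>,
  and \<open>smult c p\<close>, whose nominal degree is one too high and so contributes
  \<open>c\<close> times \<open>b\<close>.\<close>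

lemma homogenize_linear_mult:
  assumes "degree p \<le> n"
  shows "homogenize a b (Suc n) ([:- c, 1:] * p) = (a - smult c b) * homogenize a b n p"
proof -
  have "[:- c, 1:] * p = pCons 0 p - smult c p"
    by simp
  then show ?thesis
    using assms
    by (simp only: homogenize_diff homogenize_smult homogenize_pCons_0 homogenize_Suc)
      (simp add: algebra_simps)
qed

lemma has_zeros_on_mult:
  assumes "has_zeros_on p A k" "has_zeros_on q A l"
  shows "has_zeros_on (p * q) A (k + l)"
  using assms by (auto simp: has_zeros_on_def proots_mult)

lemma has_zeros_on_linear:
  assumes "d \<noteq> 0"
  shows "has_zeros_on [:e, d:] A (if - e / d \<in> A then 1 else 0)"
proof -
  have "proots [:e, d:] = proots (smult d [:e / d, 1:])"
    using assms by simp
  also have "\<dots> = {#- e / d#}"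
    using assms by (subst proots_smult) simp_all
  finally show ?thesis
    using assms by (simp add: has_zeros_on_def)
qed

text \<open>Induction on the degree, splitting off one root at a time. The factors are constrained
  only at roots of \<open>p\<close>, so that a caller can exclude the point where the factor
  degenerates to a constant.\<close>

lemma has_zeros_on_homogenize:
  assumes "has_zeros_on p B m"
    and "\<And>c. poly p c = 0 \<Longrightarrow> has_zeros_on (a - smult c b) A (if c \<in> B then 1 else 0)"
  shows "has_zeros_on (homogenize a b (degree p) p) A m"
  using assms
proof (induction "degree p" arbitrary: p m)
  case 0
  then obtain c where "p = [:c:]" "c \<noteq> 0"
    by (metis degree_eq_zeroE has_zeros_on_def pCons_0_0)
  with 0 show ?case
    by (simp add: has_zeros_on_def homogenize_def)
next
  case (Suc n)
  obtain c where "poly p c = 0"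
    using Suc.hyps(2) fundamental_theorem_of_algebra[of p] by (auto simp: constant_degree)
  then obtain q where p: "p = [:- c, 1:] * q"
    by (auto simp: poly_eq_0_iff_dvd)
  have "p \<noteq> 0"
    using Suc.prems by (simp add: has_zeros_on_def)
  then have q: "q \<noteq> 0"
    using p by auto
  then have n: "degree q = n"
    using Suc.hyps(2) unfolding p by (subst (asm) degree_mult_eq) auto
  \<comment> \<open>The count for \<open>q\<close> is not given; comparing the two counts for
    \<open>p\<close> then determines \<open>m\<close> from it.\<close>
  define l where "l = size {# z \<in># proots q. z \<in> B #}"
  have l: "has_zeros_on q B l"
    using q by (simp add: l_def has_zeros_on_def)
  have "has_zeros_on [:- c, 1:] B (if c \<in> B then 1 else 0)"
    using has_zeros_on_linear[of 1 "- c" B] by simp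
  from has_zeros_on_mult[OF this l] have m: "m = (if c \<in> B then 1 else 0) + l"
    using Suc.prems(1) by (simp add: has_zeros_on_def p)
  \<comment> \<open>Roots of \<open>q\<close> are roots of \<open>p\<close>, so the assumption on
    the factors is inherited.\<close>
  have "has_zeros_on (homogenize a b (degree q) q) A l"
    using n Suc.prems(2) by (intro Suc.hyps(1) l) (auto simp: p)
  with Suc.prems(2)[OF \<open>poly p c = 0\<close>]
  have "has_zeros_on ((a - smult c b) * homogenize a b n q) A m"
    unfolding m n by (rule has_zeros_on_mult)
  moreover have "homogenize a b (degree p) p = (a - smult c b) * homogenize a b n q"
    unfolding Suc.hyps(2)[symmetric] using n by (simp only: p homogenize_linear_mult order_refl)
  ultimately show ?case
    by (simp only:)
qed

lemma has_zeros_on_smult: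
  assumes "c \<noteq> 0" "has_zeros_on p A m"
  shows "has_zeros_on (smult c p) A m"
  using assms by (simp add: has_zeros_on_def)

text \<open>The points equidistant from \<open>\<i>\<close> and \<open>- \<i>\<close> form the real
  line.\<close>

lemma cmod_cayley_mu_eq_1_iff:
  assumes "c \<noteq> - \<i>"
  shows "cmod ((c - \<i>) / (c + \<i>)) = 1 \<longleftrightarrow> c \<in> \<real>"
proof -
  have "c + \<i> \<noteq> 0"
    using assms by (simp add: add_eq_0_iff2)
  then have "cmod ((c - \<i>) / (c + \<i>)) = 1 \<longleftrightarrow> cmod (c - \<i>) = cmod (c + \<i>)"
    by (auto simp: norm_divide)
  also have "\<dots> \<longleftrightarrow> c \<in> \<real>"
    by (auto simp: cmod_def complex_is_Real_iff power2_eq_square algebra_simps)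
  finally show ?thesis .
qed

lemma cayley_mu_inverse_real_iff:
  assumes "c \<noteq> 1"
  shows "\<i> * (1 + c) / (1 - c) \<in> \<real> \<longleftrightarrow> cmod c = 1"
proof -
  \<comment> \<open>This is the preimage of \<open>c\<close> under \<open>cayley_mu\<close>, which
    reduces the claim to the equidistance criterion at \<open>z\<close>.\<close>
  define z where "z = \<i> * (1 + c) / (1 - c)"
  have "1 - c \<noteq> 0"
    using assms by simp
  then have "z - \<i> = 2 * \<i> * c / (1 - c)" "z + \<i> = 2 * \<i> / (1 - c)"
    by (simp_all add: z_def divide_simps) (simp_all add: algebra_simps)
  with \<open>1 - c \<noteq> 0\<close> have "(z - \<i>) / (z + \<i>) = c" "z \<noteq> - \<i>"
    by auto
  then show ?thesis
    using cmod_cayley_mu_eq_1_iff[of z] unfolding z_def[symmetric] by simp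
qed

lemma has_zeros_on_q_mu:
  assumes "has_zeros_on p unit_circle m" "poly p 1 \<noteq> 0"
  shows "has_zeros_on (q_mu (degree p) p) \<real> m"
proof -
  have "has_zeros_on (homogenize [:- \<i>, 1:] [:\<i>, 1:] (degree p) p) \<real> m"
  proof (rule has_zeros_on_homogenize[OF assms(1)])
    \<comment> \<open>For \<open>c = 1\<close> the factor would be the constant
      \<open>- 2 * \<i>\<close>, without zeros, although 1 lies on the circle.\<close>
    fix c assume "poly p c = 0"
    with assms(2) have c: "c \<noteq> 1"
      by auto
    have "- (- \<i> * (1 + c)) / (1 - c) \<in> \<real> \<longleftrightarrow> c \<in> unit_circle"
      using cayley_mu_inverse_real_iff[OF c] by simp
    moreover have "[:- \<i>, 1:] - smult c [:\<i>, 1:] = [:- \<i> * (1 + c), 1 - c:]"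
      by (simp add: algebra_simps)
    ultimately show "has_zeros_on ([:- \<i>, 1:] - smult c [:\<i>, 1:]) \<real> (if c \<in> unit_circle then 1 else 0)"
      using has_zeros_on_linear[of "1 - c" "- \<i> * (1 + c)" \<real>] c by simp
  qed
  then show ?thesis
    by (simp add: q_mu_def homogenize_def)
qed

lemma has_zeros_on_q_omega:
  assumes "has_zeros_on p \<real> m" "poly p (- \<i>) \<noteq> 0"
  shows "has_zeros_on (q_omega (degree p) p) unit_circle m"
proof -
  \<comment> \<open>The powers of \<open>- \<i>\<close> in the sum are absorbed into
    \<open>?a\<close>; the prefactor is a nonzero scalar and leaves the zeros unchanged.\<close>
  let ?a = "smult (- \<i>) [:1, 1:]" and ?b = "[:- 1, 1:]"
  have "has_zeros_on (homogenize ?a ?b (degree p) p) unit_circle m"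
  proof (rule has_zeros_on_homogenize[OF assms(1)])
    fix c assume "poly p c = 0"
    with assms(2) have c: "c \<noteq> - \<i>"
      by auto
    then have "c + \<i> \<noteq> 0"
      by (simp add: add_eq_0_iff2)
    then have nz: "- (c + \<i>) \<noteq> 0"
      by (simp only: neg_equal_0_iff_equal not_False_eq_True)
    \<comment> \<open>The quotient is the root of the linear factor for \<open>c\<close>, and equals
      \<open>cayley_mu c\<close>.\<close>
    have "- (c - \<i>) / - (c + \<i>) \<in> unit_circle \<longleftrightarrow> c \<in> \<real>"
      using cmod_cayley_mu_eq_1_iff[OF c] by (simp only: minus_divide_divide mem_Collect_eq)
    moreover have "?a - smult c ?b = [:c - \<i>, - (c + \<i>):]"
      by (simp add: algebra_simps)
    ultimately show "has_zeros_on (?a - smult c ?b) unit_circle (if c \<in> \<real> then 1 else 0)"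
      using has_zeros_on_linear[OF nz, of "c - \<i>" unit_circle] by (simp only:)
  qed
  moreover have "q_omega (degree p) p = smult ((\<i> / 2) ^ degree p) (homogenize ?a ?b (degree p) p)"
    by (simp only: q_omega_def homogenize_def smult_power mult_smult_left smult_smult)
  ultimately show ?thesis
    by (simp add: has_zeros_on_smult)
qed

theorem theorem3:
  shows "(\<forall>(p :: complex poly) n m.
            degree p = n \<longrightarrow> has_zeros_on p unit_circle m \<longrightarrow> poly p 1 \<noteq> 0 \<longrightarrow>
            has_zeros_on (q_mu n p) \<real> m) \<and>
         (\<forall>(p :: complex poly) n m.
            degree p = n \<longrightarrow> has_zeros_on p \<real> m \<longrightarrow> poly p (- \<i>) \<noteq> 0 \<longrightarrow>
            has_zeros_on (q_omega n p) unit_circle m)"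
  using has_zeros_on_q_mu has_zeros_on_q_omega by blast

end
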